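(* $\mathsf{DNR}\not\le_\mathrm{W}\mathsf{wRSgr}$.
   Context: Problems are multi-valued partial functions $\subseteq\omega^\omega\rightrightarrows\omega^\omega$ with standard codings. $\mathcal{F}\le_\mathrm{W}\mathcal{G}$ if there are Turing functionals $\Phi,\Psi$ with $\Phi(f)\in\mathrm{dom}(\mathcal{G})$ for all $f\in\mathrm{dom}(\mathcal{F})$ and $\Psi(\langle f,g\rangle)\in\mathcal{F}(f)$ for all $f\in\mathrm{dom}(\mathcal F)$, $g\in\mathcal{G}(\Phi(f))$. $\mathsf{DNR}$: input $p\in\omega^\omega$; output $f\in\omega^\omega$ with $f(e)\ne\Phi_e(p)(e)$ whenever $\Phi_e(p)(e)$ converges, where $(\Phi_e)$ is the standard list of Turing functionals. Graphs $G=(V,E)$ are simple with $V\subseteq\omega$ infinite, $E\subseteq[V]^2$; $N(v)=\{y:(v,y)\in E\}$. $\mathsf{wRSgr}$: input an infinite graph; output an infinite $H\subseteq V$ with, for all $v\in H$, $|H\cap N(v)|=\omega$ or $|H\cap N(v)|=0$. *)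

theory Defs
  imports Main "HOL-Library.Nat_Bijection" "HOL-Library.Indicator_Function"
begin

type_synonym baire = "nat \<Rightarrow> nat"

text \<open>
  Oracle programs compute the unary partial functions that are partial recursive in an oracle
  \<open>p\<close>. Functions of several arguments act on arguments paired by \<^const>\<open>prod_encode\<close>, so the
  projections \<open>Fst\<close>, \<open>Snd\<close> together with \<open>Pairing\<close> replace the usual projection and
  tupling schemes.
\<close>

datatype prog =
    Zero
  | Succ
  | Fst
  | Snd
  | Query
  | Pairing prog prog
  | Comp prog prog
  | PrimRec prog prog
  | Mu prog

text \<open>
  \<open>run c p n\<close> is the value of program \<open>c\<close> with oracle \<open>p\<close> on input \<open>n\<close>, and \<open>None\<close> means
  divergence. In the minimization clause all values before the first zero must converge.
\<close>

primrec run :: "prog \<Rightarrow> baire \<Rightarrow> nat \<Rightarrow> nat option" where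
  "run Zero p n = Some 0"
| "run Succ p n = Some (Suc n)"
| "run Fst p n = Some (fst (prod_decode n))"
| "run Snd p n = Some (snd (prod_decode n))"
| "run Query p n = Some (p n)"
| "run (Pairing c d) p n =
     Option.bind (run c p n) (\<lambda>x. Option.bind (run d p n) (\<lambda>y. Some (prod_encode (x, y))))"
| "run (Comp c d) p n = Option.bind (run d p n) (run c p)"
| "run (PrimRec c d) p n =
     rec_nat (run c p (fst (prod_decode n)))
       (\<lambda>k r. Option.bind r
          (\<lambda>v. run d p (prod_encode (fst (prod_decode n), prod_encode (k, v)))))
       (snd (prod_decode n))"
| "run (Mu c) p n =
     (if \<exists>y. run c p (prod_encode (n, y)) = Some 0 \<and>
             (\<forall>z<y. \<exists>w. run c p (prod_encode (n, z)) = Some (Suc w))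
      then Some (LEAST y. run c p (prod_encode (n, y)) = Some 0)
      else None)"

primrec goedel :: "prog \<Rightarrow> nat" where
  "goedel Zero = 0"
| "goedel Succ = 1"
| "goedel Fst = 2"
| "goedel Snd = 3"
| "goedel Query = 4"
| "goedel (Pairing c d) = 5 + 4 * prod_encode (goedel c, goedel d)"
| "goedel (Comp c d) = 6 + 4 * prod_encode (goedel c, goedel d)"
| "goedel (PrimRec c d) = 7 + 4 * prod_encode (goedel c, goedel d)"
| "goedel (Mu c) = 8 + 4 * goedel c"

lemma inj_goedel: "inj goedel"
proof (rule injI)
  have neq: "5 + 4 * a \<noteq> 6 + 4 * b" "5 + 4 * a \<noteq> 7 + 4 * b" "5 + 4 * a \<noteq> 8 + 4 * b"
    "6 + 4 * a \<noteq> 7 + 4 * b" "6 + 4 * a \<noteq> 8 + 4 * b" "7 + 4 * a \<noteq> 8 + 4 * b" for a b :: nat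
    by presburger+
  note neq = neq neq[symmetric]
  show "goedel c = goedel d \<Longrightarrow> c = d" for c d
  proof (induction c arbitrary: d)
    case (Pairing c1 c2) then show ?case by (cases d) (simp_all add: neq)
  next
    case (Comp c1 c2) then show ?case by (cases d) (simp_all add: neq)
  next
    case (PrimRec c1 c2) then show ?case by (cases d) (simp_all add: neq)
  next
    case (Mu c) then show ?case by (cases d) (simp_all add: neq)
  qed (case_tac d; simp)+
qed

lemma surj_goedel: "surj goedel"
proof -
  have "\<exists>c. n = goedel c" for n
  proof (induction n rule: less_induct)
    case (less n)
    show ?case
    proof (cases "n < 5")
      case True
      then have "n = 0 \<or> n = 1 \<or> n = 2 \<or> n = 3 \<or> n = 4" by auto
      then show ?thesis using goedel.simps(1-5) by metis
    next
      case False
      define m where "m = (n - 5) div 4"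
      have m: "n = 5 + 4 * m \<or> n = 6 + 4 * m \<or> n = 7 + 4 * m \<or> n = 8 + 4 * m"
        unfolding m_def using False by presburger
      then have "m < n" by auto
      obtain a b where ab: "m = prod_encode (a, b)"
        by (metis prod_decode_inverse surj_pair)
      have "a < n" "b < n"
        using \<open>m < n\<close> le_prod_encode_1[of a b] le_prod_encode_2[of b a] ab by auto
      with less obtain c d where "a = goedel c" "b = goedel d" by blast
      moreover obtain k where "m = goedel k" using less \<open>m < n\<close> by blast
      ultimately show ?thesis using m ab goedel.simps(6-9) by metis
    qed
  qed
  then show ?thesis by (auto simp: surj_def)
qed

lemma bij_goedel: "bij goedel"
  using inj_goedel surj_goedel by (simp add: bij_def)

text \<open>The standard list: \<open>phi e p n\<close> is \<open>\<Phi>\<^sub>e(p)(n)\<close>.\<close>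

definition phi :: "nat \<Rightarrow> baire \<Rightarrow> nat \<Rightarrow> nat option" where
  "phi e = run (inv goedel e)"

text \<open>As a partial map on Baire space, \<open>\<Phi>\<^sub>e\<close> is defined at \<open>p\<close> iff \<open>\<Phi>\<^sub>e(p)\<close> is total.\<close>

definition functional :: "nat \<Rightarrow> baire \<rightharpoonup> baire" where
  "functional e p =
     (if \<forall>n. phi e p n \<noteq> None then Some (\<lambda>n. the (phi e p n)) else None)"

definition turing_functional :: "(baire \<rightharpoonup> baire) \<Rightarrow> bool" where
  "turing_functional F \<longleftrightarrow> (\<exists>e. F = functional e)"

definition join :: "baire \<Rightarrow> baire \<Rightarrow> baire" where
  "join f g = (\<lambda>n. if even n then f (n div 2) else g (n div 2))"

text \<open>
  A problem maps each element of its domain to its set of solutions; \<open>None\<close> marks the points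
  outside the domain.
\<close>

type_synonym problem = "baire \<rightharpoonup> baire set"

definition weihrauch_le :: "problem \<Rightarrow> problem \<Rightarrow> bool"  (infix \<open>\<le>\<^sub>W\<close> 50) where
  "F \<le>\<^sub>W G \<longleftrightarrow>
     (\<exists>\<Phi> \<Psi>. turing_functional \<Phi> \<and> turing_functional \<Psi> \<and>
        (\<forall>f\<in>dom F. \<exists>h. \<Phi> f = Some h \<and> h \<in> dom G \<and>
           (\<forall>g\<in>the (G h). \<exists>k. \<Psi> (join f g) = Some k \<and> k \<in> the (F f))))"

definition DNR :: problem where
  "DNR p = Some {f. \<forall>e v. phi e p e = Some v \<longrightarrow> f e \<noteq> v}"

definition infinite_graph :: "nat set \<Rightarrow> nat set set \<Rightarrow> bool" where
  "infinite_graph V E \<longleftrightarrow> infinite V \<and> E \<subseteq> {e. e \<subseteq> V \<and> card e = 2}"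

definition nbhd :: "nat set set \<Rightarrow> nat \<Rightarrow> nat set" where
  "nbhd E v = {y. {v, y} \<in> E}"

text \<open>
  A graph is presented by the characteristic functions of its vertex set and of its (symmetric)
  adjacency relation.
\<close>

definition graph_code :: "nat set \<Rightarrow> nat set set \<Rightarrow> baire" where
  "graph_code V E = join (indicator V) (indicator {prod_encode (x, y) | x y. {x, y} \<in> E})"

lemma graph_code_inject:
  assumes "infinite_graph V E" "infinite_graph V' E'" "graph_code V E = graph_code V' E'"
  shows "V = V' \<and> E = E'"
proof -
  have *: "f = f' \<and> g = g'" if "join f g = join f' g'" for f f' g g'
  proof -
    have "f n = f' n \<and> g n = g' n" for n
      using fun_cong[OF that, of "2 * n"] fun_cong[OF that, of "2 * n + 1"]
      by (simp add: join_def)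
    then show ?thesis by auto
  qed
  have ind: "A = B" if "indicator A = (indicator B :: baire)" for A B :: "nat set"
    using that by (metis indicator_eq_1_iff set_eqI)
  note codes = *[OF assms(3)[unfolded graph_code_def]]
  have V: "V = V'"
    by (rule ind[OF conjunct1[OF codes]])
  have P: "{prod_encode (x, y) | x y. {x, y} \<in> E} = {prod_encode (x, y) | x y. {x, y} \<in> E'}"
    by (rule ind[OF conjunct2[OF codes]])
  have mem: "prod_encode (x, y) \<in> {prod_encode (x, y) | x y. {x, y} \<in> D} \<longleftrightarrow> {x, y} \<in> D"
    for x y and D :: "nat set set"
    by auto
  have edge: "{x, y} \<in> E \<longleftrightarrow> {x, y} \<in> E'" for x y
    using mem[of x y E] mem[of x y E'] unfolding P by blast
  have "e \<in> E \<longleftrightarrow> e \<in> E'" for e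
  proof (cases "card e = 2")
    case True
    then show ?thesis using edge by (auto simp: card_2_iff)
  next
    case False
    then show ?thesis using assms(1,2) by (auto simp: infinite_graph_def)
  qed
  then show ?thesis using V by auto
qed

definition wRSgr_solution :: "nat set \<Rightarrow> nat set set \<Rightarrow> nat set \<Rightarrow> bool" where
  "wRSgr_solution V E H \<longleftrightarrow>
     infinite H \<and> H \<subseteq> V \<and> (\<forall>v\<in>H. infinite (H \<inter> nbhd E v) \<or> H \<inter> nbhd E v = {})"

definition wRSgr :: problem where
  "wRSgr q =
     (if \<exists>V E. infinite_graph V E \<and> q = graph_code V E
      then Some {indicator H | H V E.
             infinite_graph V E \<and> q = graph_code V E \<and> wRSgr_solution V E H}
      else None)"

lemma wRSgr_graph_code:
  assumes "infinite_graph V E"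
  shows "wRSgr (graph_code V E) = Some {indicator H | H. wRSgr_solution V E H}"
  unfolding wRSgr_def using assms graph_code_inject[OF assms] by auto

end

theory Submission
  imports Defs Complex_Main "HOL-Library.Ramsey"
begin

text \<open>
  Fix an instance \<open>p\<close> and let \<open>G = (V, E)\<close> be the graph that a reduction computes from it. Suppose that
  a \<open>p\<close>-decidable collection of finite initial segments consists of segments extendible to solutions
  of \<open>G\<close> and contains all initial segments of some solution. Searching it for a segment on which the
  backward functional converges at \<open>n\<close> defines a total \<open>p\<close>-recursive function of \<open>n\<close>. At its own
  index it agrees with the output of the backward functional on a solution extending the segment, so
  that output is not diagonally nonrecursive relative to \<open>p\<close>.

  Such a collection always exists. Intersecting \<open>V\<close> with more and more neighbourhoods produces either
  a \<open>p\<close>-decidable infinite set \<open>C\<close> on which \<open>G\<close> is locally finite or an infinite clique. In the first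
  case take the finite independent subsets of \<open>C\<close>. In the second case every finite independent set
  extends to a solution by a part of the clique, so take all of them if there is an infinite
  independent set. Otherwise only finitely many vertices have finite degree; the remaining
  vertices form a \<open>p\<close>-decidable solution, and its initial segments will do.
\<close>

section \<open>Total functions recursive in an oracle\<close>

definition rec_in :: "baire \<Rightarrow> (nat \<Rightarrow> nat) \<Rightarrow> bool" where
  "rec_in p f \<longleftrightarrow> (\<exists>c. \<forall>n. run c p n = Some (f n))"

definition dec_in :: "baire \<Rightarrow> (nat \<Rightarrow> bool) \<Rightarrow> bool" where
  "dec_in p P \<longleftrightarrow> rec_in p (\<lambda>n. if P n then 1 else 0)"

abbreviation pfst :: "nat \<Rightarrow> nat" where "pfst n \<equiv> fst (prod_decode n)"
abbreviation psnd :: "nat \<Rightarrow> nat" where "psnd n \<equiv> snd (prod_decode n)"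

lemma rec_in_comp:
  assumes "rec_in p g" "rec_in p f"
  shows "rec_in p (\<lambda>n. g (f n))"
proof -
  obtain c d where "\<forall>n. run c p n = Some (g n)" "\<forall>n. run d p n = Some (f n)"
    using assms unfolding rec_in_def by blast
  then have "\<forall>n. run (Comp c d) p n = Some (g (f n))" by simp
  then show ?thesis unfolding rec_in_def by blast
qed

lemma dec_in_comp: "dec_in p P \<Longrightarrow> rec_in p f \<Longrightarrow> dec_in p (\<lambda>n. P (f n))"
  unfolding dec_in_def using rec_in_comp by blast

named_theorems rec_intros

lemma rec_in_pair [rec_intros]:
  assumes "rec_in p f" "rec_in p g"
  shows "rec_in p (\<lambda>n. prod_encode (f n, g n))"
proof -
  obtain c d where "\<forall>n. run c p n = Some (f n)" "\<forall>n. run d p n = Some (g n)"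
    using assms unfolding rec_in_def by blast
  then have "\<forall>n. run (Pairing c d) p n = Some (prod_encode (f n, g n))" by simp
  then show ?thesis unfolding rec_in_def by blast
qed

lemma rec_in_pfst [rec_intros]: "rec_in p f \<Longrightarrow> rec_in p (\<lambda>n. pfst (f n))"
  by (rule rec_in_comp) (auto simp: rec_in_def intro: exI[of _ Fst])

lemma rec_in_psnd [rec_intros]: "rec_in p f \<Longrightarrow> rec_in p (\<lambda>n. psnd (f n))"
  by (rule rec_in_comp) (auto simp: rec_in_def intro: exI[of _ Snd])

lemma rec_in_Suc [rec_intros]: "rec_in p f \<Longrightarrow> rec_in p (\<lambda>n. Suc (f n))"
  by (rule rec_in_comp) (auto simp: rec_in_def intro: exI[of _ Succ])

lemma rec_in_oracle [rec_intros]: "rec_in p f \<Longrightarrow> rec_in p (\<lambda>n. p (f n))"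
  by (rule rec_in_comp) (auto simp: rec_in_def intro: exI[of _ Query])

lemma rec_in_id [rec_intros]: "rec_in p (\<lambda>n. n)"
  unfolding rec_in_def by (rule exI[of _ "Pairing Fst Snd"]) simp

lemma rec_in_const [rec_intros]: "rec_in p (\<lambda>n. k)"
proof (induction k)
  case 0
  show ?case unfolding rec_in_def by (rule exI[of _ Zero]) simp
next
  case (Suc k)
  then show ?case by (rule rec_in_Suc)
qed

text \<open>\<open>PrimRec\<close> recurses on the second component of its input and carries the
  first along as a parameter; composing with \<open>prod_encode (n, b n)\<close> lets start value,
  step and bound all depend on \<open>n\<close>.\<close>

lemma rec_in_rec_nat [rec_intros]:
  assumes f: "rec_in p f"
    and g: "rec_in p (\<lambda>m. g (pfst m) (pfst (psnd m)) (psnd (psnd m)))"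
    and b: "rec_in p b"
  shows "rec_in p (\<lambda>n. rec_nat (f n) (g n) (b n))"
proof -
  obtain c d where c: "\<forall>n. run c p n = Some (f n)"
    and d: "\<forall>m. run d p m = Some (g (pfst m) (pfst (psnd m)) (psnd (psnd m)))"
    using f g unfolding rec_in_def by blast
  have "run (PrimRec c d) p m = Some (rec_nat (f (pfst m)) (g (pfst m)) (psnd m))" for m
  proof -
    have "rec_nat (run c p x) (\<lambda>k r. Option.bind r
        (\<lambda>v. run d p (prod_encode (x, prod_encode (k, v))))) y
      = Some (rec_nat (f x) (g x) y)" for x y
      by (induction y) (simp_all add: c d)
    then show ?thesis by simp
  qed
  then have "rec_in p (\<lambda>m. rec_nat (f (pfst m)) (g (pfst m)) (psnd m))"
    unfolding rec_in_def by blast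
  from rec_in_comp[OF this rec_in_pair[OF rec_in_id b]] show ?thesis by simp
qed

lemma rec_in_if [rec_intros]:
  assumes "dec_in p P" "rec_in p f" "rec_in p g"
  shows "rec_in p (\<lambda>n. if P n then f n else g n)"
proof -
  \<comment> \<open>The characteristic function of \<open>P\<close> is the recursion bound, so the
    single step is taken exactly when \<open>P n\<close> holds.\<close>
  have "rec_in p (\<lambda>n. rec_nat (g n) (\<lambda>k r. f n) (if P n then 1 else 0))"
    using assms(1) unfolding dec_in_def
    by (intro rec_intros rec_in_comp[OF assms(2)] assms(3))
  moreover have "rec_nat (g n) (\<lambda>k r. f n) (if P n then 1 else 0) = (if P n then f n else g n)" for n
    by simp
  ultimately show ?thesis by simp
qed

section \<open>Arithmetic and decidable predicates\<close>

lemma rec_in_pred [rec_intros]: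
  assumes "rec_in p f" shows "rec_in p (\<lambda>n. f n - 1)"
proof -
  have "rec_in p (\<lambda>n. rec_nat 0 (\<lambda>k r. k) (f n))"
    using assms by (intro rec_intros)
  moreover have "rec_nat 0 (\<lambda>k r. k) m = m - 1" for m by (cases m) auto
  ultimately show ?thesis by simp
qed

lemma rec_in_add [rec_intros]:
  assumes "rec_in p f" "rec_in p g" shows "rec_in p (\<lambda>n. f n + g n)"
proof -
  have "rec_in p (\<lambda>n. rec_nat (f n) (\<lambda>k r. Suc r) (g n))"
    using assms by (intro rec_intros)
  moreover have "rec_nat a (\<lambda>k r. Suc r) m = a + m" for a m by (induction m) auto
  ultimately show ?thesis by simp
qed

lemma rec_in_diff [rec_intros]:
  assumes "rec_in p f" "rec_in p g" shows "rec_in p (\<lambda>n. f n - g n)"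
proof -
  have "rec_in p (\<lambda>n. rec_nat (f n) (\<lambda>k r. r - 1) (g n))"
    using assms by (intro rec_intros)
  moreover have "rec_nat a (\<lambda>k r. r - 1) m = a - m" for a m by (induction m) auto
  ultimately show ?thesis by simp
qed

lemma dec_in_eq_0:
  assumes "rec_in p f" shows "dec_in p (\<lambda>n. f n = 0)"
proof -
  have "rec_in p (\<lambda>n. 1 - f n)" using assms by (intro rec_intros)
  moreover have "1 - m = (if m = 0 then 1 else 0)" for m :: nat by simp
  ultimately show ?thesis unfolding dec_in_def by simp
qed

lemma dec_in_less [rec_intros]:
  assumes "rec_in p f" "rec_in p g" shows "dec_in p (\<lambda>n. f n < g n)"
proof -
  have "dec_in p (\<lambda>n. Suc (f n) - g n = 0)"
    using assms by (intro dec_in_eq_0 rec_intros)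
  then show ?thesis by (simp add: Suc_le_eq)
qed

lemma dec_in_eq [rec_intros]:
  assumes "rec_in p f" "rec_in p g" shows "dec_in p (\<lambda>n. f n = g n)"
proof -
  have "dec_in p (\<lambda>n. (f n - g n) + (g n - f n) = 0)"
    using assms by (intro dec_in_eq_0 rec_intros)
  moreover have "(f n - g n) + (g n - f n) = 0 \<longleftrightarrow> f n = g n" for n by auto
  ultimately show ?thesis by simp
qed

lemma dec_in_not [rec_intros]:
  assumes "dec_in p P" shows "dec_in p (\<lambda>n. \<not> P n)"
proof -
  have "rec_in p (\<lambda>n. if P n then 0 else 1)" using assms by (intro rec_intros)
  moreover have "(if P n then 0 else 1) = (if \<not> P n then 1 else (0::nat))" for n by simp
  ultimately show ?thesis unfolding dec_in_def by simp
qed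

lemma dec_in_conj [rec_intros]:
  assumes "dec_in p P" "dec_in p Q" shows "dec_in p (\<lambda>n. P n \<and> Q n)"
proof -
  have "rec_in p (\<lambda>n. if P n then (if Q n then 1 else 0) else 0)"
    using assms by (intro rec_intros)
  moreover have "(if P n then (if Q n then 1 else 0) else 0) = (if P n \<and> Q n then 1 else (0::nat))"
    for n by simp
  ultimately show ?thesis unfolding dec_in_def by simp
qed

lemma dec_in_imp [rec_intros]:
  assumes "dec_in p P" "dec_in p Q" shows "dec_in p (\<lambda>n. P n \<longrightarrow> Q n)"
proof -
  have "dec_in p (\<lambda>n. \<not> (P n \<and> \<not> Q n))" using assms by (intro rec_intros)
  then show ?thesis by simp
qed

lemma dec_in_iff [rec_intros]:
  assumes "dec_in p P" "dec_in p Q" shows "dec_in p (\<lambda>n. P n \<longleftrightarrow> Q n)"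
proof -
  have "dec_in p (\<lambda>n. (P n \<longrightarrow> Q n) \<and> (Q n \<longrightarrow> P n))" using assms by (intro rec_intros)
  moreover have "((P n \<longrightarrow> Q n) \<and> (Q n \<longrightarrow> P n)) = (P n \<longleftrightarrow> Q n)" for n by blast
  ultimately show ?thesis by simp
qed

lemma dec_in_all_less [rec_intros]:
  assumes "rec_in p b" "dec_in p (\<lambda>m. P (pfst m) (psnd m))"
  shows "dec_in p (\<lambda>n. \<forall>x<b n. P n x)"
proof -
  have P: "dec_in p (\<lambda>m. P (pfst m) (pfst (psnd m)))"
    using dec_in_comp[OF assms(2), of "\<lambda>m. prod_encode (pfst m, pfst (psnd m))"]
    by (simp add: rec_intros)
  have "rec_in p (\<lambda>n. rec_nat 1 (\<lambda>k r. if P n k then r else 0) (b n))"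
    by (intro rec_intros assms(1) P)
  moreover have "rec_nat 1 (\<lambda>k r. if P n k then r else 0) m = (if \<forall>x<m. P n x then 1 else (0::nat))"
    for n m by (induction m) (auto simp: less_Suc_eq)
  ultimately show ?thesis unfolding dec_in_def by simp
qed

lemma rec_in_Least:
  assumes P: "dec_in p (\<lambda>m. P (pfst m) (psnd m))" and ex: "\<And>n. \<exists>y. P n y"
  shows "rec_in p (\<lambda>n. LEAST y. P n y)"
proof -
  \<comment> \<open>\<open>Mu\<close> searches for a zero, so truth is coded by 0 here, opposite to
    \<open>dec_in\<close>.\<close>
  obtain c where c: "\<forall>m. run c p m = Some (if P (pfst m) (psnd m) then 0 else 1)"
    using rec_in_if[OF P rec_in_const[of p 0] rec_in_const[of p 1]] unfolding rec_in_def by blast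
  have "run (Mu c) p n = Some (LEAST y. P n y)" for n
  proof -
    have c0: "run c p (prod_encode (n, y)) = Some 0 \<longleftrightarrow> P n y"
      "(\<exists>w. run c p (prod_encode (n, y)) = Some (Suc w)) \<longleftrightarrow> \<not> P n y" for y
      using c by auto
    have "\<exists>y. P n y \<and> (\<forall>z<y. \<not> P n z)"
      using exists_least_iff[of "P n"] ex by blast
    then show ?thesis by (simp only: run.simps c0 if_True)
  qed
  then show ?thesis unfolding rec_in_def by blast
qed

section \<open>Parity, halving and coded finite sets\<close>

lemma rec_in_mod2 [rec_intros]:
  assumes "rec_in p f" shows "rec_in p (\<lambda>n. f n mod 2)"
proof -
  have "rec_in p (\<lambda>n. rec_nat 0 (\<lambda>k r. 1 - r) (f n))"
    using assms by (intro rec_intros)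
  moreover have "rec_nat 0 (\<lambda>k r. 1 - r) m = m mod 2" for m :: nat
    by (induction m) (auto simp: mod_Suc)
  ultimately show ?thesis by simp
qed

lemma rec_in_div2 [rec_intros]:
  assumes "rec_in p f" shows "rec_in p (\<lambda>n. f n div 2)"
proof -
  have "rec_in p (\<lambda>n. rec_nat 0 (\<lambda>k r. r + k mod 2) (f n))"
    using assms by (intro rec_intros)
  moreover have "rec_nat 0 (\<lambda>k r. r + k mod 2) m = m div 2" for m :: nat
    by (induction m) (simp, simp, presburger)
  ultimately show ?thesis by simp
qed

lemma dec_in_even [rec_intros]:
  assumes "rec_in p f" shows "dec_in p (\<lambda>n. even (f n))"
proof -
  have "dec_in p (\<lambda>n. f n mod 2 = 0)" using assms by (intro rec_intros)
  then show ?thesis by (simp only: even_iff_mod_2_eq_zero)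
qed

lemma dec_in_set_decode [rec_intros]:
  assumes "rec_in p f" "rec_in p g" shows "dec_in p (\<lambda>n. f n \<in> set_decode (g n))"
proof -
  \<comment> \<open>Halving the code \<open>m\<close> times brings bit \<open>m\<close>, which
    decides membership of \<open>m\<close>, to the last place.\<close>
  have "rec_nat a (\<lambda>k r. r div 2) m = a div 2 ^ m" for a m :: nat
    by (induction m) (simp_all add: div_mult2_eq power_Suc2 del: power_Suc)
  then have eq: "(\<lambda>n. f n \<in> set_decode (g n)) =
      (\<lambda>n. \<not> even (rec_nat (g n) (\<lambda>k r. r div 2) (f n)))"
    by (simp add: set_decode_def)
  show ?thesis unfolding eq using assms by (intro rec_intros)
qed

section \<open>Simulation with bounded resources\<close>

text \<open>
  The fuel \<open>t\<close> bounds both the minimizations and the oracle queries, so the result only depends on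
  the oracle below \<open>t\<close>. The value is \<open>0\<close> if the fuel does not suffice and \<open>Suc v\<close> if the program
  returns \<open>v\<close>. In the minimization clause the state of the search is \<open>0\<close> while no zero has been
  found, \<open>1\<close> after a failure, and \<open>y + 2\<close> once the zero \<open>y\<close> has been found.
\<close>

primrec brun :: "prog \<Rightarrow> baire \<Rightarrow> nat \<Rightarrow> nat \<Rightarrow> nat" where
  "brun Zero q t n = Suc 0"
| "brun Succ q t n = Suc (Suc n)"
| "brun Fst q t n = Suc (pfst n)"
| "brun Snd q t n = Suc (psnd n)"
| "brun Query q t n = (if n < t then Suc (q n) else 0)"
| "brun (Pairing c d) q t n =
     (if brun c q t n = 0 then 0 else if brun d q t n = 0 then 0
      else Suc (prod_encode (brun c q t n - 1, brun d q t n - 1)))"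
| "brun (Comp c d) q t n = (if brun d q t n = 0 then 0 else brun c q t (brun d q t n - 1))"
| "brun (PrimRec c d) q t n =
     rec_nat (brun c q t (pfst n))
       (\<lambda>k r. if r = 0 then 0 else brun d q t (prod_encode (pfst n, prod_encode (k, r - 1))))
       (psnd n)"
| "brun (Mu c) q t n =
     rec_nat 0
       (\<lambda>k r. if r = 0 then
                (if brun c q t (prod_encode (n, k)) = 0 then 1
                 else if brun c q t (prod_encode (n, k)) = 1 then Suc (Suc k) else 0)
              else r)
       t - 1"

lemma brun_cong:
  assumes "\<And>i. i < t \<Longrightarrow> q i = q' i"
  shows "brun c q t n = brun c q' t n"
proof (induction c arbitrary: n)
  case Query
  then show ?case using assms by simp
qed (simp_all cong: if_cong)

lemma brun_sound: "brun c q t n = Suc v \<Longrightarrow> run c q n = Some v"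
proof (induction c arbitrary: n v)
  case (Pairing c d)
  then obtain x y where "brun c q t n = Suc x" "brun d q t n = Suc y"
    by (cases "brun c q t n"; cases "brun d q t n") auto
  then show ?case using Pairing by simp
next
  case (Comp c d)
  then obtain x where "brun d q t n = Suc x"
    by (cases "brun d q t n") auto
  then show ?case using Comp by simp
next
  case (PrimRec c d)
  let ?b = "rec_nat (brun c q t (pfst n))
       (\<lambda>k r. if r = 0 then 0 else brun d q t (prod_encode (pfst n, prod_encode (k, r - 1))))"
  let ?r = "rec_nat (run c q (pfst n)) (\<lambda>k r. Option.bind r
          (\<lambda>v. run d q (prod_encode (pfst n, prod_encode (k, v)))))"
  have "?b k = Suc w \<Longrightarrow> ?r k = Some w" for k w
  proof (induction k arbitrary: w)
    case 0
    then show ?case using PrimRec.IH(1) by simp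
  next
    case (Suc k)
    then obtain u where "?b k = Suc u" by (cases "?b k") auto
    then show ?case using Suc PrimRec.IH(2) by simp
  qed
  then show ?case using PrimRec.prems by simp
next
  case (Mu c)
  let ?m = "rec_nat 0
       (\<lambda>k r. if r = 0 then
                (if brun c q t (prod_encode (n, k)) = 0 then 1
                 else if brun c q t (prod_encode (n, k)) = 1 then Suc (Suc k) else 0)
              else r)"
  \<comment> \<open>In state 0 every tested value was positive; a state \<open>y + 2\<close>
    certifies \<open>y\<close> as the first zero. Nothing is claimed in state 1.\<close>
  have inv: "(?m k = 0 \<longrightarrow> (\<forall>z<k. \<exists>w. run c q (prod_encode (n, z)) = Some (Suc w))) \<and>
    (\<forall>y. ?m k = Suc (Suc y) \<longrightarrow> run c q (prod_encode (n, y)) = Some 0 \<and>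
       (\<forall>z<y. \<exists>w. run c q (prod_encode (n, z)) = Some (Suc w)))" for k
  proof (induction k)
    case (Suc k)
    show ?case
    proof (cases "?m k = 0")
      case True
      consider "brun c q t (prod_encode (n, k)) = 0" | "brun c q t (prod_encode (n, k)) = Suc 0"
        | w where "brun c q t (prod_encode (n, k)) = Suc (Suc w)"
        by (metis not0_implies_Suc)
      then show ?thesis
        using True Suc by cases (auto simp: less_Suc_eq dest: Mu.IH)
    next
      case False
      then show ?thesis using Suc by simp
    qed
  qed simp
  \<comment> \<open>The final \<open>- 1\<close> in \<open>brun\<close> sends both unsuccessful
    states 0 and 1 to 0, so a positive result comes only from a zero that was found.\<close>
  have "?m t = Suc (Suc v)" using Mu.prems by simp
  with inv have v: "run c q (prod_encode (n, v)) = Some 0"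
       "\<forall>z<v. \<exists>w. run c q (prod_encode (n, z)) = Some (Suc w)" by blast+
  have "(LEAST y. run c q (prod_encode (n, y)) = Some 0) = v"
  proof (rule Least_equality, rule v(1))
    fix y assume "run c q (prod_encode (n, y)) = Some 0"
    then show "v \<le> y" using v(2) by (metis not_le option.inject nat.distinct(1))
  qed
  then show ?case using v by auto
qed (auto split: if_splits)

text \<open>A converging run makes finitely many queries and tests. Phrased with
  \<open>eventually\<close>, the thresholds of the subcomputations merge into one fuel.\<close>

lemma brun_complete:
  "run c q n = Some v \<Longrightarrow> eventually (\<lambda>t. brun c q t n = Suc v) sequentially"
proof (induction c arbitrary: n v)
  case Query
  have "eventually (\<lambda>t. n < t) sequentially" by (rule eventually_gt_at_top)
  then show ?case using Query by (auto elim: eventually_mono)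
next
  case (Pairing c d)
  then obtain x y where "run c q n = Some x" "run d q n = Some y" "v = prod_encode (x, y)"
    by (auto simp: Option.bind_eq_Some_conv)
  then have "eventually (\<lambda>t. brun c q t n = Suc x) sequentially"
    "eventually (\<lambda>t. brun d q t n = Suc y) sequentially"
    using Pairing.IH by blast+
  then show ?case
    by eventually_elim (simp add: \<open>v = _\<close>)
next
  case (Comp c d)
  then obtain x where "run d q n = Some x" "run c q x = Some v"
    by (auto simp: Option.bind_eq_Some_conv)
  then have "eventually (\<lambda>t. brun d q t n = Suc x) sequentially"
    "eventually (\<lambda>t. brun c q t x = Suc v) sequentially"
    using Comp.IH by blast+
  then show ?case by eventually_elim simp
next
  case (PrimRec c d)
  let ?b = "\<lambda>t. rec_nat (brun c q t (pfst n))
       (\<lambda>k r. if r = 0 then 0 else brun d q t (prod_encode (pfst n, prod_encode (k, r - 1))))"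
  let ?r = "rec_nat (run c q (pfst n)) (\<lambda>k r. Option.bind r
          (\<lambda>v. run d q (prod_encode (pfst n, prod_encode (k, v)))))"
  have "?r k = Some w \<Longrightarrow> eventually (\<lambda>t. ?b t k = Suc w) sequentially" for k w
  proof (induction k arbitrary: w)
    case 0
    then show ?case using PrimRec.IH(1) by simp
  next
    case (Suc k)
    then obtain u where u: "?r k = Some u"
      "run d q (prod_encode (pfst n, prod_encode (k, u))) = Some w"
      by (auto simp: Option.bind_eq_Some_conv)
    show ?case
      using Suc.IH[OF u(1)] PrimRec.IH(2)[OF u(2)] by eventually_elim simp
  qed
  then show ?case using PrimRec.prems by simp
next
  case (Mu c)
  let ?m = "\<lambda>t. rec_nat 0
       (\<lambda>k r. if r = 0 then
                (if brun c q t (prod_encode (n, k)) = 0 then 1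
                 else if brun c q t (prod_encode (n, k)) = 1 then Suc (Suc k) else 0)
              else r)"
  obtain y where y: "run c q (prod_encode (n, y)) = Some 0"
    "\<forall>z<y. \<exists>w. run c q (prod_encode (n, z)) = Some (Suc w)"
    using Mu.prems by (auto split: if_splits)
  have "(LEAST y. run c q (prod_encode (n, y)) = Some 0) = y"
  proof (rule Least_equality, rule y(1))
    fix x assume "run c q (prod_encode (n, x)) = Some 0"
    then show "y \<le> x" using y(2) by (metis not_le option.inject nat.distinct(1))
  qed
  then have [simp]: "v = y" using Mu.prems by (auto split: if_splits)
  \<comment> \<open>The strict bound excludes both 0 (fuel exhausted) and 1 (the code of value
    zero), so the search moves on past \<open>z\<close>.\<close>
  have "eventually (\<lambda>t. 1 < brun c q t (prod_encode (n, z))) sequentially"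
    if z: "z < y" for z
  proof -
    obtain w where "run c q (prod_encode (n, z)) = Some (Suc w)" using y z by blast
    from Mu.IH[OF this] show ?thesis by (auto elim: eventually_mono)
  qed
  then have "eventually (\<lambda>t. \<forall>z\<in>{..<y}. 1 < brun c q t (prod_encode (n, z))) sequentially"
    by (intro eventually_ball_finite) auto
  moreover have "eventually (\<lambda>t. brun c q t (prod_encode (n, y)) = Suc 0) sequentially"
    using Mu.IH[OF y(1)] .
  \<comment> \<open>The search tests only arguments below \<open>t\<close>, so \<open>y\<close> must
    be among them.\<close>
  moreover have "eventually (\<lambda>t. y < t) sequentially" by (rule eventually_gt_at_top)
  ultimately show ?case
  proof eventually_elim
    case (elim t)
    have "k \<le> y \<Longrightarrow> ?m t k = 0" for k
    proof (induction k)
      case (Suc k)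
      then have "1 < brun c q t (prod_encode (n, k))" using elim(1) by simp
      then show ?case using Suc by simp
    qed simp
    then have found: "?m t (Suc y) = Suc (Suc y)" using elim(2) by simp
    have "?m t k = Suc (Suc y)" if "Suc y \<le> k" for k
      using that
    proof (induction k rule: nat_induct_at_least)
      case base
      show ?case by (rule found)
    next
      case (Suc k)
      then show ?case by simp
    qed
    from this[OF Suc_leI[OF elim(3)]] have "?m t t = Suc (Suc y)" .
    then show ?case by (simp only: brun.simps \<open>v = y\<close> diff_Suc_1)
  qed
qed auto

text \<open>The program is fixed while the coded finite set, the fuel and the input vary with
  \<open>n\<close>, which makes a search over segments recursive in \<open>p\<close>. Subprograms
  run on intermediate values, hence the generalization over \<open>s\<close>, \<open>t\<close> and
  \<open>x\<close>.\<close>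

lemma rec_in_brun:
  assumes "rec_in p s" "rec_in p t" "rec_in p x"
  shows "rec_in p (\<lambda>n. brun c (join p (indicator (set_decode (s n)))) (t n) (x n))"
  using assms
proof (induction c arbitrary: s t x)
  case Query
  have "dec_in p (\<lambda>n. x n div 2 \<in> set_decode (s n))" using Query by (intro rec_intros)
  then show ?case
    unfolding brun.simps join_def indicator_def of_bool_def using Query by (intro rec_intros)
next
  case (Pairing c d)
  show ?case unfolding brun.simps using Pairing.prems by (intro rec_intros Pairing.IH)
next
  case (Comp c d)
  show ?case unfolding brun.simps using Comp.prems by (intro rec_intros Comp.IH)
next
  case (PrimRec c d)
  \<comment> \<open>Inside the loop, \<open>s\<close>, \<open>t\<close> and \<open>x\<close> are
    evaluated at the parameter component of the coded state.\<close>
  note comp = PrimRec.prems[THEN rec_in_comp]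
  show ?case unfolding brun.simps by (intro rec_intros PrimRec.IH comp)
next
  case (Mu c)
  note comp = Mu.prems[THEN rec_in_comp]
  show ?case unfolding brun.simps by (intro rec_intros Mu.IH comp)
qed (unfold brun.simps, (intro rec_intros; assumption)+)

section \<open>Diagonalization\<close>

text \<open>The segments of the one solution \<open>H\<close> make the search total;
  \<open>extend\<close> turns the segment found into a genuine solution, possibly different from
  \<open>H\<close>, with the same computed value.\<close>

lemma solution_meeting_diagonal:
  assumes R: "dec_in p (\<lambda>m. R (pfst m) (psnd m))"
    and extend: "\<And>s t. R s t \<Longrightarrow> \<exists>H. Sol H \<and> (\<forall>x<t. x \<in> H \<longleftrightarrow> x \<in> set_decode s)"
    and H: "Sol H" "\<And>t. \<exists>s. R s t \<and> (\<forall>x<t. x \<in> H \<longleftrightarrow> x \<in> set_decode s)"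
    and total: "\<And>H n. Sol H \<Longrightarrow> run c (join p (indicator H)) n \<noteq> None"
  shows "\<exists>e v H. Sol H \<and> phi e p e = Some v \<and> run c (join p (indicator H)) e = Some v"
proof -
  \<comment> \<open>\<open>y\<close> codes a pair \<open>(s, t)\<close>, where \<open>t\<close> is
    both the length of the segment and the fuel.\<close>
  define B where "B n y = brun c (join p (indicator (set_decode (pfst y)))) (psnd y) n" for n y
  define T where "T n y \<longleftrightarrow> R (pfst y) (psnd y) \<and> B n y \<noteq> 0" for n y
  \<comment> \<open>\<open>join\<close> puts membership of \<open>x\<close> at position
    \<open>2 * x + 1\<close>, so an odd position below \<open>t\<close> concerns only some
    \<open>x < t\<close>.\<close>
  have agree: "brun c (join p (indicator A)) t n = brun c (join p (indicator A')) t n"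
    if "\<forall>x<t. x \<in> A \<longleftrightarrow> x \<in> A'" for A A' t n
    using that by (intro brun_cong) (auto simp: join_def indicator_def)
  have "\<exists>y. T n y" for n
  proof -
    obtain v where "run c (join p (indicator H)) n = Some v" using total[OF H(1)] by blast
    from brun_complete[OF this] obtain t where "brun c (join p (indicator H)) t n = Suc v"
      by (auto simp: eventually_sequentially)
    moreover obtain s where "R s t" "\<forall>x<t. x \<in> H \<longleftrightarrow> x \<in> set_decode s" using H(2) by blast
    ultimately have "T n (prod_encode (s, t))"
      using agree[of t H "set_decode s" n] by (simp add: T_def B_def)
    then show ?thesis by blast
  qed
  then have T: "T n (LEAST y. T n y)" for n by (rule LeastI_ex)
  have decT: "dec_in p (\<lambda>m. T (pfst m) (psnd m))"
    unfolding T_def B_def by (intro rec_intros rec_in_brun dec_in_comp[OF R])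
  have "rec_in p (\<lambda>n. LEAST y. T n y)"
    by (rule rec_in_Least[OF decT]) fact
  then have "rec_in p (\<lambda>n. B n (LEAST y. T n y) - 1)"
    unfolding B_def by (intro rec_intros rec_in_brun)
  then obtain d where d: "\<forall>n. run d p n = Some (B n (LEAST y. T n y) - 1)"
    unfolding rec_in_def by blast
  \<comment> \<open>\<open>d\<close> is total, so it converges on its own index, and
    \<open>phi e p e\<close> is its value there.\<close>
  define e where "e = goedel d"
  define y where "y = (LEAST y. T e y)"
  obtain v where v: "B e y = Suc v" using T[of e] unfolding T_def y_def by (metis not0_implies_Suc)
  have "phi e p e = Some v"
    using d v by (simp add: phi_def e_def y_def inj_goedel)
  moreover obtain H' where H': "Sol H'" "\<forall>x<psnd y. x \<in> H' \<longleftrightarrow> x \<in> set_decode (pfst y)"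
    using T[of e] extend unfolding T_def y_def by blast
  moreover have "run c (join p (indicator H')) e = Some v"
    using v agree[OF H'(2)] by (intro brun_sound[where t = "psnd y"]) (simp add: B_def)
  ultimately show ?thesis by blast
qed

section \<open>Solutions of the graph problem\<close>

definition indep_set :: "nat set set \<Rightarrow> nat set \<Rightarrow> bool" where
  "indep_set E F \<longleftrightarrow> (\<forall>x\<in>F. \<forall>y\<in>F. y \<notin> nbhd E x)"

lemma nbhd_sym: "y \<in> nbhd E x \<longleftrightarrow> x \<in> nbhd E y"
  by (simp add: nbhd_def insert_commute)

lemma nbhd_irrefl: "infinite_graph V E \<Longrightarrow> x \<notin> nbhd E x"
  by (auto simp: nbhd_def infinite_graph_def)

lemma independent_solution:
  "infinite H \<Longrightarrow> H \<subseteq> V \<Longrightarrow> indep_set E H \<Longrightarrow> wRSgr_solution V E H"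
  by (auto simp: wRSgr_solution_def indep_set_def)

text \<open>Ramsey's theorem gives an infinite homogeneous set. It is not a clique, since a vertex
  of an infinite clique inside \<open>D\<close> would have infinitely many neighbours in
  \<open>D\<close>.\<close>

lemma locally_finite_infinite_independent:
  assumes "infinite_graph V E" "infinite D" "\<And>x. x \<in> D \<Longrightarrow> finite (D \<inter> nbhd E x)"
  shows "\<exists>I\<subseteq>D. infinite I \<and> indep_set E I"
proof -
  define col :: "nat set \<Rightarrow> nat" where "col e = (if e \<in> E then 1 else 0)" for e
  obtain Y t where Y: "Y \<subseteq> D" "infinite Y" "\<forall>x\<in>Y. \<forall>y\<in>Y. x \<noteq> y \<longrightarrow> col {x, y} = t"
    using Ramsey2[OF assms(2), of col 2] by (metis col_def one_less_numeral_iff semiring_norm(76) zero_less_numeral)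
  have "t = 0"
  proof (rule ccontr)
    assume "t \<noteq> 0"
    obtain x where x: "x \<in> Y" using Y(2) by (metis finite.emptyI ex_in_conv)
    have "Y - {x} \<subseteq> D \<inter> nbhd E x"
      using Y(1,3) x \<open>t \<noteq> 0\<close> by (force simp: col_def nbhd_def)
    then have "finite (Y - {x})" using assms(3) x Y(1) by (meson finite_subset subsetD)
    then show False using Y(2) by simp
  qed
  then have "y \<notin> nbhd E x" if "x \<in> Y" "y \<in> Y" for x y
    using Y(3) that nbhd_irrefl[OF assms(1)]
    by (cases "x = y") (auto simp: col_def nbhd_def split: if_splits)
  then show ?thesis using Y unfolding indep_set_def by blast
qed

text \<open>Discarding the numbers below \<open>t\<close> and the finitely many neighbours of
  \<open>F\<close> in \<open>C\<close> leaves an infinite locally finite set; an infinite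
  independent subset of it has no edge to \<open>F\<close>.\<close>

lemma extend_independent_locally_finite:
  assumes G: "infinite_graph V E" and C: "infinite C" "C \<subseteq> V" "\<And>x. x \<in> C \<Longrightarrow> finite (C \<inter> nbhd E x)"
    and F: "F \<subseteq> C" "F \<subseteq> {..<t}" "indep_set E F"
  shows "\<exists>H. wRSgr_solution V E H \<and> (\<forall>x<t. x \<in> H \<longleftrightarrow> x \<in> F)"
proof -
  define D where "D = C - (\<Union>x\<in>F. C \<inter> nbhd E x) - {..<t}"
  have "finite (\<Union>x\<in>F. C \<inter> nbhd E x)"
    using F(1) C(3) finite_subset[OF F(2)] by (intro finite_UN_I) auto
  then have "infinite D" unfolding D_def using C(1) by simp
  moreover have "finite (D \<inter> nbhd E x)" if "x \<in> D" for x
    using that C(3)[of x] by (auto simp: D_def elim: rev_finite_subset)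
  ultimately obtain I where I: "I \<subseteq> D" "infinite I" "indep_set E I"
    using locally_finite_infinite_independent[OF G] by blast
  have "y \<notin> nbhd E x \<and> x \<notin> nbhd E y" if "x \<in> F" "y \<in> I" for x y
    using that I(1) nbhd_sym[of y E x] by (auto simp: D_def)
  then have "indep_set E (F \<union> I)"
    using F(3) I(3) unfolding indep_set_def by blast
  then have "wRSgr_solution V E (F \<union> I)"
    using I C(2) F(1) by (intro independent_solution) (auto simp: D_def)
  moreover have "\<forall>x<t. x \<in> F \<union> I \<longleftrightarrow> x \<in> F" using I(1) by (auto simp: D_def)
  ultimately show ?thesis by blast
qed

text \<open>Pigeonhole once per element \<open>a\<close> of \<open>F\<close>: the current infinite
  set has an infinite part inside or outside \<open>N a\<close>, and the alternatives settled before
  persist in subsets.\<close>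

lemma infinite_homogeneous_subset:
  assumes "finite F" "infinite K"
  shows "\<exists>K'\<subseteq>K. infinite K' \<and> (\<forall>x\<in>F. K' \<subseteq> N x \<or> K' \<inter> N x = {})"
  using assms(1)
proof (induction F)
  case empty
  then show ?case using assms(2) by auto
next
  case (insert a F)
  then obtain K' where K': "K' \<subseteq> K" "infinite K'" "\<forall>x\<in>F. K' \<subseteq> N x \<or> K' \<inter> N x = {}" by blast
  have "infinite (K' \<inter> N a) \<or> infinite (K' - N a)"
    using K'(2) by (metis Int_Diff_Un finite_UnI)
  then show ?case
  proof
    assume "infinite (K' \<inter> N a)"
    then show ?thesis using K' by (intro exI[of _ "K' \<inter> N a"]) blast
  next
    assume "infinite (K' - N a)"
    then show ?thesis using K' by (intro exI[of _ "K' - N a"]) blast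
  qed
qed

text \<open>Thin the clique to an infinite \<open>D\<close> beyond \<open>t\<close> that each vertex
  of \<open>F\<close> sees entirely or not at all. Vertices of \<open>D\<close> have infinitely many
  neighbours in \<open>D\<close>, and those of \<open>F\<close> have none in
  \<open>F\<close>.\<close>

lemma extend_independent_clique:
  assumes K: "infinite K" "K \<subseteq> V" "\<And>x y. x \<in> K \<Longrightarrow> y \<in> K \<Longrightarrow> x \<noteq> y \<Longrightarrow> y \<in> nbhd E x"
    and F: "F \<subseteq> V" "F \<subseteq> {..<t}" "indep_set E F"
  shows "\<exists>H. wRSgr_solution V E H \<and> (\<forall>x<t. x \<in> H \<longleftrightarrow> x \<in> F)"
proof -
  obtain K' where K': "K' \<subseteq> K" "infinite K'" "\<forall>x\<in>F. K' \<subseteq> nbhd E x \<or> K' \<inter> nbhd E x = {}"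
    using infinite_homogeneous_subset[OF finite_subset[OF F(2)] K(1)] by blast
  define D where "D = K' - {..<t}"
  have D: "infinite D" "D \<subseteq> K" "\<forall>x\<in>F. D \<subseteq> nbhd E x \<or> D \<inter> nbhd E x = {}"
    using K' by (auto simp: D_def)
  have "infinite ((F \<union> D) \<inter> nbhd E v) \<or> (F \<union> D) \<inter> nbhd E v = {}" if "v \<in> F \<union> D" for v
  proof (cases "v \<in> D")
    case True
    then have "D - {v} \<subseteq> (F \<union> D) \<inter> nbhd E v" using K(3) D(2) by blast
    then show ?thesis using D(1) by (meson finite_subset infinite_remove)
  next
    case False
    then have v: "v \<in> F" using that by blast
    then consider "D \<subseteq> (F \<union> D) \<inter> nbhd E v" | "(F \<union> D) \<inter> nbhd E v = {}"
      using D(3) F(3) unfolding indep_set_def by blast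
    then show ?thesis using D(1) finite_subset by cases blast+
  qed
  then have "wRSgr_solution V E (F \<union> D)"
    using D K(2) F(1) unfolding wRSgr_solution_def by blast
  moreover have "\<forall>x<t. x \<in> F \<union> D \<longleftrightarrow> x \<in> F" by (auto simp: D_def)
  ultimately show ?thesis by blast
qed

text \<open>\<open>P\<close> stands for decidability in \<open>p\<close>. Every set reached arises
  by finitely many intersections and so keeps \<open>P\<close>; the clique comes from infinitely
  many choices, and \<open>P\<close> is not claimed for it.\<close>

lemma infinite_clique_or_locally_finite:
  assumes G: "infinite_graph V E" and "P V"
    and P: "\<And>C x. P C \<Longrightarrow> P (C \<inter> nbhd E x)"
  obtains C where "P C" "C \<subseteq> V" "infinite C" "\<And>x. x \<in> C \<Longrightarrow> finite (C \<inter> nbhd E x)"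
  | K where "infinite K" "K \<subseteq> V" "\<And>x y. x \<in> K \<Longrightarrow> y \<in> K \<Longrightarrow> x \<noteq> y \<Longrightarrow> y \<in> nbhd E x"
proof (cases "\<exists>C. P C \<and> C \<subseteq> V \<and> infinite C \<and> (\<forall>x\<in>C. finite (C \<inter> nbhd E x))")
  case True
  then show ?thesis using that(1) by blast
next
  case False
  \<comment> \<open>A state is the current set with the next clique vertex; the infinite
    neighbourhood of that vertex in the set allows the construction to continue.\<close>
  define Q where "Q = (\<lambda>(C, x). P C \<and> C \<subseteq> V \<and> x \<in> C \<and> infinite (C \<inter> nbhd E x))"
  have step: "\<exists>x. Q (C, x)" if "P C" "C \<subseteq> V" "infinite C" for C
    using False that by (auto simp: Q_def)
  have "\<exists>f. \<forall>n. Q (f n) \<and> fst (f (Suc n)) = fst (f n) \<inter> nbhd E (snd (f n))"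
  proof (rule dependent_nat_choice)
    show "\<exists>z. Q z" using step[of V] assms(2) G by (auto simp: infinite_graph_def)
  next
    fix z :: "nat set \<times> nat" and n :: nat assume "Q z"
    then obtain x where "Q (fst z \<inter> nbhd E (snd z), x)"
      using step[of "fst z \<inter> nbhd E (snd z)"] P unfolding Q_def case_prod_beta by auto
    then show "\<exists>w. Q w \<and> fst w = fst z \<inter> nbhd E (snd z)" by force
  qed
  then obtain f where f: "\<And>n. Q (f n)" "\<And>n. fst (f (Suc n)) = fst (f n) \<inter> nbhd E (snd (f n))"
    by blast
  have mem: "snd (f n) \<in> fst (f n)" "fst (f n) \<subseteq> V" for n
    using f(1)[of n] by (simp_all add: Q_def case_prod_beta)
  \<comment> \<open>The later vertex lies in \<open>fst (f n)\<close>, hence in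
    \<open>fst (f (Suc m))\<close>, which is contained in the neighbourhood of the earlier
    one.\<close>
  have adj: "snd (f n) \<in> nbhd E (snd (f m))" if "m < n" for m n
  proof -
    have "fst (f (Suc n)) \<subseteq> fst (f n)" for n unfolding f(2) by blast
    then have "fst (f n) \<subseteq> fst (f (Suc m))"
      using Suc_leI[OF that] by (rule lift_Suc_antimono_le[of "\<lambda>n. fst (f n)"])
    then show ?thesis using mem(1)[of n] f(2)[of m] by blast
  qed
  have "inj (\<lambda>n. snd (f n))"
  proof (rule linorder_injI)
    show "snd (f m) \<noteq> snd (f n)" if "m < n" for m n
      using adj[OF that] nbhd_irrefl[OF G, of "snd (f m)"] by auto
  qed
  then have "infinite (range (\<lambda>n. snd (f n)))" by (rule range_inj_infinite)
  moreover have "range (\<lambda>n. snd (f n)) \<subseteq> V" using mem by blast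
  moreover have "y \<in> nbhd E x"
    if xy: "x \<in> range (\<lambda>n. snd (f n))" "y \<in> range (\<lambda>n. snd (f n))" "x \<noteq> y" for x y
  proof -
    obtain m n where mn: "x = snd (f m)" "y = snd (f n)" using xy(1,2) by blast
    then consider "m < n" | "n < m" using xy(3) by (metis linorder_neqE_nat)
    then show ?thesis
      using adj[of m n] adj[of n m] nbhd_sym[of x E y] by cases (simp_all add: mn)
  qed
  ultimately show ?thesis using that(2) by blast
qed

text \<open>Only \<open>C\<close> and adjacency have to be decidable. The set \<open>I\<close> may
  be arbitrarily complex, as it merely ensures that the search succeeds.\<close>

lemma independent_solution_meeting_diagonal:
  assumes C: "dec_in p (\<lambda>x. x \<in> C)" "C \<subseteq> V" and E: "dec_in p (\<lambda>m. psnd m \<in> nbhd E (pfst m))"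
    and I: "I \<subseteq> C" "infinite I" "indep_set E I"
    and extend: "\<And>F t. F \<subseteq> C \<Longrightarrow> F \<subseteq> {..<t} \<Longrightarrow> indep_set E F \<Longrightarrow>
      \<exists>H. wRSgr_solution V E H \<and> (\<forall>x<t. x \<in> H \<longleftrightarrow> x \<in> F)"
    and total: "\<And>H n. wRSgr_solution V E H \<Longrightarrow> run c (join p (indicator H)) n \<noteq> None"
  shows "\<exists>e v H. wRSgr_solution V E H \<and> phi e p e = Some v \<and> run c (join p (indicator H)) e = Some v"
proof -
  \<comment> \<open>All quantifiers are bounded by \<open>t\<close>, which makes independence of the
    segment decidable; elements of the coded set from \<open>t\<close> on are ignored.\<close>
  define R where "R s t \<longleftrightarrow> (\<forall>x<t. x \<in> set_decode s \<longrightarrow>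
    x \<in> C \<and> (\<forall>y<t. y \<in> set_decode s \<longrightarrow> y \<notin> nbhd E x))" for s t
  have E': "dec_in p (\<lambda>n. g n \<in> nbhd E (f n))" if "rec_in p f" "rec_in p g" for f g
    using dec_in_comp[OF E rec_in_pair[OF that]] by simp
  show ?thesis
  proof (rule solution_meeting_diagonal[where R = R and H = I])
    show "dec_in p (\<lambda>m. R (pfst m) (psnd m))"
      unfolding R_def by (intro rec_intros E' dec_in_comp[OF C(1)])
    show "\<exists>H. wRSgr_solution V E H \<and> (\<forall>x<t. x \<in> H \<longleftrightarrow> x \<in> set_decode s)" if "R s t" for s t
      using extend[of "set_decode s \<inter> {..<t}" t] that by (auto simp: R_def indep_set_def)
    show "wRSgr_solution V E I" using I C(2) by (intro independent_solution) auto
    show "\<exists>s. R s t \<and> (\<forall>x<t. x \<in> I \<longleftrightarrow> x \<in> set_decode s)" for t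
      using I by (intro exI[of _ "set_encode (I \<inter> {..<t})"]) (auto simp: R_def indep_set_def)
  qed (rule total)
qed

lemma recursive_graph_solution_meeting_diagonal:
  assumes G: "infinite_graph V E" and rec: "rec_in p (graph_code V E)"
    and total: "\<And>H n. wRSgr_solution V E H \<Longrightarrow> run c (join p (indicator H)) n \<noteq> None"
  shows "\<exists>e v H. wRSgr_solution V E H \<and> phi e p e = Some v \<and> run c (join p (indicator H)) e = Some v"
proof -
  \<comment> \<open>Even positions of the graph code hold the vertices, odd ones the edges.\<close>
  have "dec_in p (\<lambda>x. graph_code V E (x + x) = 1)"
    by (intro rec_intros rec_in_comp[OF rec])
  moreover have "graph_code V E (x + x) = 1 \<longleftrightarrow> x \<in> V" for x
    by (simp add: graph_code_def join_def indicator_def flip: mult_2)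
  ultimately have decV: "dec_in p (\<lambda>x. x \<in> V)" by simp
  have "dec_in p (\<lambda>m. graph_code V E (Suc (m + m)) = 1)"
    by (intro rec_intros rec_in_comp[OF rec])
  moreover have "graph_code V E (Suc (m + m)) = 1 \<longleftrightarrow> psnd m \<in> nbhd E (pfst m)" for m
  proof -
    have "m \<in> {prod_encode (x, y) |x y. {x, y} \<in> E} \<longleftrightarrow> {pfst m, psnd m} \<in> E"
    proof -
      have "m = prod_encode (pfst m, psnd m)" by simp
      then show ?thesis by (smt (verit) mem_Collect_eq prod_encode_inverse fst_conv snd_conv)
    qed
    then show ?thesis
      by (simp add: graph_code_def join_def indicator_def nbhd_def flip: mult_2)
  qed
  ultimately have decE: "dec_in p (\<lambda>m. psnd m \<in> nbhd E (pfst m))" by simp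
  \<comment> \<open>The vertex \<open>x\<close> enters the decision program as a constant.\<close>
  have decN: "dec_in p (\<lambda>y. y \<in> C \<inter> nbhd E x)" if "dec_in p (\<lambda>y. y \<in> C)" for C x
    using dec_in_conj[OF that dec_in_comp[OF decE rec_in_pair[OF rec_in_const rec_in_id]]] by simp
  note search = independent_solution_meeting_diagonal[OF _ _ decE _ _ _ _ total]
  show ?thesis
  proof (rule infinite_clique_or_locally_finite[OF G, of "\<lambda>C. dec_in p (\<lambda>y. y \<in> C)", OF decV decN])
    fix C assume C: "dec_in p (\<lambda>y. y \<in> C)" "C \<subseteq> V" "infinite C"
      "\<And>x. x \<in> C \<Longrightarrow> finite (C \<inter> nbhd E x)"
    then obtain I where "I \<subseteq> C" "infinite I" "indep_set E I"
      using locally_finite_infinite_independent[OF G] by blast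
    then show ?thesis
      using search[OF C(1,2)] extend_independent_locally_finite[OF G C(3,2,4)] by blast
  next
    fix K assume K: "infinite K" "K \<subseteq> V" "\<And>x y. x \<in> K \<Longrightarrow> y \<in> K \<Longrightarrow> x \<noteq> y \<Longrightarrow> y \<in> nbhd E x"
    show ?thesis
    proof (cases "\<exists>I\<subseteq>V. infinite I \<and> indep_set E I")
      case True
      then show ?thesis
        using search[OF decV order_refl] extend_independent_clique[OF K] by blast
    next
      case False
      define L where "L = {x \<in> V. finite (V \<inter> nbhd E x)}"
      \<comment> \<open>The graph on \<open>L\<close> is locally finite, so an infinite
        \<open>L\<close> would contain an infinite independent set, which this case
        excludes.\<close>
      have "finite L"
      proof (rule ccontr)
        assume "infinite L"
        moreover have "finite (L \<inter> nbhd E x)" if "x \<in> L" for x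
        proof -
          have "L \<inter> nbhd E x \<subseteq> V \<inter> nbhd E x" by (auto simp: L_def)
          moreover have "finite (V \<inter> nbhd E x)" using that by (simp add: L_def)
          ultimately show ?thesis by (rule finite_subset)
        qed
        ultimately obtain I where "I \<subseteq> L" "infinite I" "indep_set E I"
          using locally_finite_infinite_independent[OF G] by blast
        then show False using False by (auto simp: L_def)
      qed
      have sol: "wRSgr_solution V E (V - L)"
        unfolding wRSgr_solution_def
      proof (intro conjI ballI disjI1)
        show "infinite (V - L)" using G \<open>finite L\<close> by (simp add: infinite_graph_def)
      next
        fix v assume "v \<in> V - L"
        then have "infinite (V \<inter> nbhd E v - L)" using \<open>finite L\<close> by (simp add: L_def)
        moreover have "V \<inter> nbhd E v - L = (V - L) \<inter> nbhd E v" by blast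
        ultimately show "infinite ((V - L) \<inter> nbhd E v)" by simp
      qed auto
      \<comment> \<open>The finitely many exceptions are hard-wired into the program for
        \<open>V\<close> one at a time.\<close>
      have decL: "dec_in p (\<lambda>x. x \<in> V - L)"
        using \<open>finite L\<close>
      proof (induction L)
        case empty
        then show ?case using decV by simp
      next
        case (insert a L)
        have "dec_in p (\<lambda>x. x \<in> V - L \<and> \<not> x = a)" by (intro rec_intros insert.IH)
        moreover have "(x \<in> V - L \<and> \<not> x = a) = (x \<in> V - insert a L)" for x by auto
        ultimately show ?case by simp
      qed
      show ?thesis
      \<comment> \<open>\<open>R\<close> accepts only segments of \<open>V - L\<close>, so
        \<open>V - L\<close> itself extends each of them.\<close>
      proof (rule solution_meeting_diagonal[where H = "V - L"
            and R = "\<lambda>s t. \<forall>x<t. x \<in> V - L \<longleftrightarrow> x \<in> set_decode s"])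
        show "dec_in p (\<lambda>m. \<forall>x<psnd m. x \<in> V - L \<longleftrightarrow> x \<in> set_decode (pfst m))"
          by (intro dec_in_all_less dec_in_iff dec_in_comp[OF decL] rec_intros)
        show "\<exists>s. (\<forall>x<t. x \<in> V - L \<longleftrightarrow> x \<in> set_decode s) \<and> (\<forall>x<t. x \<in> V - L \<longleftrightarrow> x \<in> set_decode s)"
          for t
          by (intro exI[of _ "set_encode ((V - L) \<inter> {..<t})"]) auto
      qed (use sol total in auto)
    qed
  qed
qed

section \<open>Refuting a reduction\<close>

theorem theorem6p8: "\<not> DNR \<le>\<^sub>W wRSgr"
proof
  assume "DNR \<le>\<^sub>W wRSgr"
  then obtain a b where red: "\<And>f. f \<in> dom DNR \<Longrightarrow> \<exists>h. functional a f = Some h \<and> h \<in> dom wRSgr \<and>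
      (\<forall>g\<in>the (wRSgr h). \<exists>k. functional b (join f g) = Some k \<and> k \<in> the (DNR f))"
    unfolding weihrauch_le_def turing_functional_def by blast
  \<comment> \<open>Every oracle is an instance of \<open>DNR\<close>; a single one already yields
    the contradiction.\<close>
  define p :: baire where "p = (\<lambda>_. 0)"
  have "p \<in> dom DNR" by (simp add: dom_def DNR_def)
  from red[OF this] obtain h where h: "functional a p = Some h" "h \<in> dom wRSgr"
    and solved: "\<And>g. g \<in> the (wRSgr h) \<Longrightarrow> \<exists>k. functional b (join p g) = Some k \<and> k \<in> the (DNR p)"
    by blast
  from h(2) obtain V E where G: "infinite_graph V E" and hG: "h = graph_code V E"
    by (auto simp: wRSgr_def dom_def split: if_splits)
  have "run (inv goedel a) p n = Some (h n)" for n
    using h(1) by (auto simp: functional_def phi_def split: if_splits)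
  then have rec: "rec_in p (graph_code V E)" unfolding rec_in_def hG by blast
  have sol: "\<exists>k. (\<forall>n. run (inv goedel b) (join p (indicator H)) n = Some (k n)) \<and> k \<in> the (DNR p)"
    if "wRSgr_solution V E H" for H
  proof -
    have "indicator H \<in> the (wRSgr h)"
      unfolding hG wRSgr_graph_code[OF G] using that by auto
    from solved[OF this] obtain k where "functional b (join p (indicator H)) = Some k" "k \<in> the (DNR p)"
      by blast
    moreover from this have "run (inv goedel b) (join p (indicator H)) n = Some (k n)" for n
      by (auto simp: functional_def phi_def split: if_splits)
    ultimately show ?thesis by blast
  qed
  have total: "run (inv goedel b) (join p (indicator H)) n \<noteq> None" if "wRSgr_solution V E H" for H n
    using sol[OF that] by auto
  obtain e v H where H: "wRSgr_solution V E H" and e: "phi e p e = Some v"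
    and v: "run (inv goedel b) (join p (indicator H)) e = Some v"
    using recursive_graph_solution_meeting_diagonal[OF G rec total] by blast
  obtain k where "run (inv goedel b) (join p (indicator H)) e = Some (k e)" "k \<in> the (DNR p)"
    using sol[OF H] by blast
  then show False using e v by (auto simp: DNR_def)
qed

end
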